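(* Consider the generalized Lie equations (GLE) for $S_gA$, $$u^{s}_{j}(g)\frac{\partial (S_gA)^{\mu}}{\partial g^{s}}+T^{\nu}_{j}(A)\frac{\partial (S_gA)^{\mu}}{\partial A^{\nu}}+P^{\mu}_{j}(S_gA)=0,$$ $$v^{s}_{j}(g)\frac{\partial (S_gA)^{\mu}}{\partial g^{s}}+P^{\nu}_{j}(A)\frac{\partial (S_gA)^{\mu}}{\partial A^{\nu}}+T^{\mu}_{j}(S_gA)=0,$$ $$w^{s}_{j}(g)\frac{\partial (S_gA)^{\mu}}{\partial g^{s}}+S^{\nu}_{j}(A)\frac{\partial (S_gA)^{\mu}}{\partial A^{\nu}}+S^{\mu}_{j}(S_gA)=0,$$ and the GLE for $T_gA$, $$v^{s}_{j}(g)\frac{\partial (T_gA)^{\mu}}{\partial g^{s}}+S^{\nu}_{j}(A)\frac{\partial (T_gA)^{\mu}}{\partial A^{\nu}}+P^{\mu}_{j}(T_gA)=0,$$ $$u^{s}_{j}(g)\frac{\partial (T_gA)^{\mu}}{\partial g^{s}}+P^{\nu}_{j}(A)\frac{\partial (T_gA)^{\mu}}{\partial A^{\nu}}+S^{\mu}_{j}(T_gA)=0,$$ $$w^{s}_{j}(g)\frac{\partial (T_gA)^{\mu}}{\partial g^{s}}+T^{\nu}_{j}(A)\frac{\partial (T_gA)^{\mu}}{\partial A^{\nu}}+T^{\mu}_{j}(T_gA)=0,$$ for all indices $j,\mu$. The integrability conditions of the GLE for $S_gA$ and of the GLE for $T_gA$ read (that is, modulo the respective GLE, they are equivalent to), respectively,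 $$Y^s_{jk}(g)\frac{\partial (S_gA)^\mu}{\partial g^s}+Y^\nu_{jk}(A)\frac{\partial (S_gA)^\mu}{\partial A^\nu}=Y^\mu_{jk}(S_gA),$$ $$Y^s_{jk}(g)\frac{\partial (T_gA)^\mu}{\partial g^s}+Y^\nu_{jk}(A)\frac{\partial (T_gA)^\mu}{\partial A^\nu}=Y^\mu_{jk}(T_gA),$$ for all indices $j,k,\mu$.
   Context: Summation over repeated indices is understood. $G$ is an analytic Moufang loop with unit $e$, $g^s$ are local coordinates on $G$, and indices $j,k,p,s$ run over $1,\dots,\dim G$. $\mathfrak X$ is a manifold with local coordinates $A^\nu$, and indices $\lambda,\mu,\nu$ run over $1,\dots,\dim\mathfrak X$. $G$ acts on $\mathfrak X$ by continuous (smooth) Moufang transformations: there are maps $(g,A)\mapsto S_gA$ and $(g,A)\mapsto T_gA$ from $G\times\mathfrak X$ to $\mathfrak X$, satisfying the GLE displayed in the claim. Auxiliary functions. $u^s_j,v^s_j,w^s_j$ are smooth functions on $G$ and $S^\mu_j,T^\mu_j,P^\mu_j$ are smooth functions on $\mathfrak X$, with $$u^s_j+v^s_j+w^s_j=0,\qquad S^\mu_j+T^\mu_j+P^\mu_j=0.$$ For $x\in T_e(G)$ with components $x^j$ define the vector fields on $G$ $$L_x=x^ju^s_j(g)\frac{\partial}{\partial g^s},\quad R_x=x^jv^s_j(g)\frac{\partial}{\partial g^s},\quad M_x=x^jw^s_j(g)\frac{\partial}{\partial g^s},$$ and on $\mathfrak X$ $$S_x=x^jS^\nu_j(A)\frac{\partial}{\partial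 A^\nu},\quad T_x=x^jT^\nu_j(A)\frac{\partial}{\partial A^\nu},\quad P_x=x^jP^\nu_j(A)\frac{\partial}{\partial A^\nu}.$$ Thus $L_x+R_x+M_x=0$ and $S_x+T_x+P_x=0$. With the usual commutator of vector fields, and with $[x,y]$ the (bilinear, skew-symmetric) bracket of the tangent algebra $T_e(G)$, the following generalized Maurer–Cartan equations are standing known facts, for all $x,y\in T_e(G)$: $$[L_x,L_y]=L_{[x,y]}-2[L_x,R_y],\quad [R_x,R_y]=R_{[y,x]}-2[R_x,L_y],\quad [L_x,R_y]=[R_x,L_y],$$ $$[S_x,S_y]=S_{[x,y]}-2[S_x,T_y],\quad [T_x,T_y]=T_{[y,x]}-2[T_x,S_y],\quad [S_x,T_y]=[T_x,S_y].$$ Secondary auxiliary functions and Yamaguti functions. Put $$u^s_{jk}(g)=u^p_k\frac{\partial u^s_j}{\partial g^p}-u^p_j\frac{\partial u^s_k}{\partial g^p},\qquad S^\mu_{jk}(A)=S^\nu_k\frac{\partial S^\mu_j}{\partial A^\nu}-S^\nu_j\frac{\partial S^\mu_k}{\partial A^\nu},$$ and define $v^s_{jk},w^s_{jk}$ from $v,w$, and $T^\mu_{jk},P^\mu_{jk}$ from $T,P$, by the same formulas. The Yamaguti functions on $G$ and on $\mathfrak X$ are $$Y^s_{jk}(g)=\tfrac16\big(u^s_{jk}(g)+v^s_{jk}(g)+w^s_{jk}(g)\big),\qquad Y^\mu_{jk}(A)=\tfrac16\big(S^\mu_{jk}(A)+T^\mu_{jk}(A)+P^\mu_{jk}(A)\big).$$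 Integrability conditions. Each of the two GLE systems consists of three families of equations of the form $X_j\varphi^\mu+F^\mu_j(\varphi)=0$, where $\varphi(g,A)=S_gA$ (resp. $T_gA$), $X_j$ is a vector field on $G\times\mathfrak X$ and $F^\mu_j$ are functions on $\mathfrak X$ (for example, in the first family for $S_gA$, $X_j=u^s_j(g)\partial/\partial g^s+T^\nu_j(A)\partial/\partial A^\nu$ and $F_j^\mu=P_j^\mu$). The integrability conditions of the system are the relations, for each of its three families and all $j,k,\mu$, obtained as follows: apply $X_k$ to the $j$-th equation and $X_j$ to the $k$-th equation of the same family, subtract, cancel the second-order partial derivatives of $\varphi$ using their symmetry ($\partial^2\varphi^\mu/\partial g^j\partial g^k$, $\partial^2\varphi^\mu/\partial g^j\partial A^\nu$ and $\partial^2\varphi^\mu/\partial A^\lambda\partial A^\nu$ are symmetric in the order of differentiation), and substitute $X_j\varphi^\nu=-F^\nu_j(\varphi)$ in the terms coming from differentiating $F(\varphi)$. They are relations between $g$, $A$, the value $\varphi$ and the first-order partial derivatives of $\varphi$. "Equivalent modulo the GLE" means: for values of $g,A,\varphi$ and first-order partial derivatives of $\varphi$ that satisfy the GLE of the system, the integrability conditions of all three families (for all $j,k,\mu$) hold if and only if the stated relations (for all $j,k,\mu$) hold. *)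

theory Defs
  imports "HOL-Analysis.Analysis"
begin

section \<open>Smooth and real analytic functions on open subsets of Euclidean spaces\<close>

primrec Ck_on :: "nat \<Rightarrow> ('a::euclidean_space \<Rightarrow> 'b::real_normed_vector) \<Rightarrow> 'a set \<Rightarrow> bool" where
  "Ck_on 0 f U \<longleftrightarrow> continuous_on U f"
| "Ck_on (Suc k) f U \<longleftrightarrow> (\<forall>x\<in>U. f differentiable (at x)) \<and>
     (\<forall>b\<in>Basis. Ck_on k (\<lambda>x. frechet_derivative f (at x) b) U)"

definition smooth_on :: "('a::euclidean_space \<Rightarrow> 'b::real_normed_vector) \<Rightarrow> 'a set \<Rightarrow> bool" where
  "smooth_on f U \<longleftrightarrow> (\<forall>k. Ck_on k f U)"

text \<open>Local expansion into a multivariate power series; a multi-index is an extensional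
  function from the standard basis to the natural numbers.\<close>

definition real_analytic_on :: "('a::euclidean_space \<Rightarrow> 'b::real_normed_vector) \<Rightarrow> 'a set \<Rightarrow> bool" where
  "real_analytic_on f U \<longleftrightarrow>
     (\<forall>a\<in>U. \<exists>r>0. ball a r \<subseteq> U \<and> (\<exists>c. \<forall>x\<in>ball a r.
        ((\<lambda>\<alpha>. (\<Prod>b\<in>Basis. ((x - a) \<bullet> b) ^ \<alpha> b) *\<^sub>R c \<alpha>) has_sum f x) (Basis \<rightarrow>\<^sub>E UNIV)))"


section \<open>Manifolds\<close>

text \<open>A manifold is a topological type together with an atlas. The parameter \<open>reg\<close> is the
  regularity class: \<open>smooth_on\<close> or \<open>real_analytic_on\<close>.\<close>

type_synonym ('a, 'n) chart = "'a set \<times> ('a \<Rightarrow> real ^ 'n)"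

abbreviation dom_of :: "('a, 'n) chart \<Rightarrow> 'a set" where
  "dom_of \<kappa> \<equiv> fst \<kappa>"

abbreviation coords :: "('a, 'n) chart \<Rightarrow> 'a \<Rightarrow> real ^ 'n" where
  "coords \<kappa> \<equiv> snd \<kappa>"

abbreviation coord_range :: "('a, 'n) chart \<Rightarrow> (real ^ 'n) set" where
  "coord_range \<kappa> \<equiv> coords \<kappa> ` dom_of \<kappa>"

definition point_at :: "('a, 'n) chart \<Rightarrow> real ^ 'n \<Rightarrow> 'a" where
  "point_at \<kappa> = inv_into (dom_of \<kappa>) (coords \<kappa>)"

definition is_chart :: "('a::topological_space, 'n::finite) chart \<Rightarrow> bool" where
  "is_chart \<kappa> \<longleftrightarrow> open (dom_of \<kappa>) \<and> open (coord_range \<kappa>) \<and>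
     homeomorphism (dom_of \<kappa>) (coord_range \<kappa>) (coords \<kappa>) (point_at \<kappa>)"

definition transition_regular ::
  "((real ^ 'n \<Rightarrow> real ^ 'n) \<Rightarrow> (real ^ 'n) set \<Rightarrow> bool) \<Rightarrow>
   ('a, 'n::finite) chart \<Rightarrow> ('a, 'n) chart \<Rightarrow> bool" where
  "transition_regular reg \<kappa> \<kappa>' \<longleftrightarrow>
     reg (\<lambda>x. coords \<kappa>' (point_at \<kappa> x)) (coords \<kappa> ` (dom_of \<kappa> \<inter> dom_of \<kappa>'))"

definition manifold_atlas ::
  "((real ^ 'n \<Rightarrow> real ^ 'n) \<Rightarrow> (real ^ 'n) set \<Rightarrow> bool) \<Rightarrow>
   ('a::{t2_space, second_countable_topology}, 'n::finite) chart set \<Rightarrow> bool" where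
  "manifold_atlas reg \<A> \<longleftrightarrow> (\<forall>\<kappa>\<in>\<A>. is_chart \<kappa>) \<and> (\<Union>\<kappa>\<in>\<A>. dom_of \<kappa>) = UNIV \<and>
     (\<forall>\<kappa>\<in>\<A>. \<forall>\<kappa>'\<in>\<A>. transition_regular reg \<kappa> \<kappa>')"

definition local_coordinates ::
  "((real ^ 'n \<Rightarrow> real ^ 'n) \<Rightarrow> (real ^ 'n) set \<Rightarrow> bool) \<Rightarrow>
   ('a::{t2_space, second_countable_topology}, 'n::finite) chart set \<Rightarrow> ('a, 'n) chart \<Rightarrow> bool" where
  "local_coordinates reg \<A> \<kappa> \<longleftrightarrow> is_chart \<kappa> \<and>
     (\<forall>\<kappa>'\<in>\<A>. transition_regular reg \<kappa> \<kappa>' \<and> transition_regular reg \<kappa>' \<kappa>)"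

definition regular_map ::
  "((real ^ 'n \<Rightarrow> real ^ 'm) \<Rightarrow> (real ^ 'n) set \<Rightarrow> bool) \<Rightarrow>
   ('a::topological_space, 'n::finite) chart set \<Rightarrow> ('b::topological_space, 'm::finite) chart set \<Rightarrow>
   ('a \<Rightarrow> 'b) \<Rightarrow> bool" where
  "regular_map reg \<A> \<B> f \<longleftrightarrow> continuous_on UNIV f \<and>
     (\<forall>\<kappa>\<in>\<A>. \<forall>\<kappa>'\<in>\<B>. reg (\<lambda>x. coords \<kappa>' (f (point_at \<kappa> x)))
        {x \<in> coord_range \<kappa>. f (point_at \<kappa> x) \<in> dom_of \<kappa>'})"

text \<open>The same for a map from a product manifold, with product charts on the source.\<close>

definition regular_map2 ::
  "(((real ^ 'n) \<times> (real ^ 'm) \<Rightarrow> real ^ 'k) \<Rightarrow> ((real ^ 'n) \<times> (real ^ 'm)) set \<Rightarrow> bool) \<Rightarrow>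
   ('a::topological_space, 'n::finite) chart set \<Rightarrow> ('b::topological_space, 'm::finite) chart set \<Rightarrow>
   ('c::topological_space, 'k::finite) chart set \<Rightarrow> ('a \<Rightarrow> 'b \<Rightarrow> 'c) \<Rightarrow> bool" where
  "regular_map2 reg \<A> \<B> \<C> f \<longleftrightarrow> continuous_on UNIV (\<lambda>(a, b). f a b) \<and>
     (\<forall>\<kappa>\<in>\<A>. \<forall>\<kappa>'\<in>\<B>. \<forall>\<kappa>''\<in>\<C>.
        reg (\<lambda>(x, y). coords \<kappa>'' (f (point_at \<kappa> x) (point_at \<kappa>' y)))
          {(x, y). x \<in> coord_range \<kappa> \<and> y \<in> coord_range \<kappa>' \<and>
                   f (point_at \<kappa> x) (point_at \<kappa>' y) \<in> dom_of \<kappa>''})"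


section \<open>Analytic Moufang loops\<close>

definition moufang_loop :: "('g \<Rightarrow> 'g \<Rightarrow> 'g) \<Rightarrow> 'g \<Rightarrow> bool" where
  "moufang_loop m e \<longleftrightarrow>
     (\<forall>a b. \<exists>!x. m a x = b) \<and> (\<forall>a b. \<exists>!y. m y a = b) \<and>
     (\<forall>a. m e a = a \<and> m a e = a) \<and>
     (\<forall>a g h. m (m a g) (m h a) = m (m a (m g h)) a)"

definition loop_inverse :: "('g \<Rightarrow> 'g \<Rightarrow> 'g) \<Rightarrow> 'g \<Rightarrow> 'g \<Rightarrow> 'g" where
  "loop_inverse m e g = (THE h. m g h = e)"

definition analytic_moufang_loop ::
  "('g::{t2_space, second_countable_topology}, 'n::finite) chart set \<Rightarrow>
   ('g \<Rightarrow> 'g \<Rightarrow> 'g) \<Rightarrow> 'g \<Rightarrow> bool" where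
  "analytic_moufang_loop \<A> m e \<longleftrightarrow>
     moufang_loop m e \<and> manifold_atlas real_analytic_on \<A> \<and>
     regular_map2 real_analytic_on \<A> \<A> \<A> m \<and>
     regular_map real_analytic_on \<A> \<A> (loop_inverse m e)"


section \<open>Component functions and vector fields in local coordinates\<close>

text \<open>Functions with indices are written with the lower (parameter) index first:
  \<open>u j s g\<close> stands for \<open>u\<^sup>s\<^sub>j(g)\<close>. A vector field is given by its components,
  \<open>\<xi> s g\<close> standing for \<open>\<xi>\<^sup>s(g)\<close>.\<close>

definition smooth_fun :: "('a, 'n::finite) chart \<Rightarrow> ('a \<Rightarrow> real) \<Rightarrow> bool" where
  "smooth_fun \<kappa> f \<longleftrightarrow> smooth_on (\<lambda>x. f (point_at \<kappa> x)) (coord_range \<kappa>)"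

text \<open>The partial derivative of \<open>f\<close> with respect to the \<open>i\<close>-th coordinate of \<open>\<kappa>\<close>, at the point \<open>a\<close>.\<close>

definition pd :: "('a, 'n::finite) chart \<Rightarrow> 'n \<Rightarrow> ('a \<Rightarrow> real) \<Rightarrow> 'a \<Rightarrow> real" where
  "pd \<kappa> i f a = frechet_derivative (\<lambda>x. f (point_at \<kappa> x)) (at (coords \<kappa> a)) (axis i 1)"

definition commutator ::
  "('a, 'n::finite) chart \<Rightarrow> ('n \<Rightarrow> 'a \<Rightarrow> real) \<Rightarrow> ('n \<Rightarrow> 'a \<Rightarrow> real) \<Rightarrow> 'n \<Rightarrow> 'a \<Rightarrow> real" where
  "commutator \<kappa> \<xi> \<eta> s a = (\<Sum>p\<in>UNIV. \<xi> p a * pd \<kappa> p (\<eta> s) a - \<eta> p a * pd \<kappa> p (\<xi> s) a)"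

text \<open>The vector field \<open>L\<^sub>x\<close> of an auxiliary function \<open>u\<close>, where \<open>x\<close> is the tuple of components of
  a tangent vector at the unit (likewise \<open>R\<^sub>x\<close>, \<open>M\<^sub>x\<close>, \<open>S\<^sub>x\<close>, \<open>T\<^sub>x\<close>, \<open>P\<^sub>x\<close>).\<close>

definition field :: "('n::finite \<Rightarrow> 'i \<Rightarrow> 'a \<Rightarrow> real) \<Rightarrow> real ^ 'n \<Rightarrow> 'i \<Rightarrow> 'a \<Rightarrow> real" where
  "field u x s a = (\<Sum>j\<in>UNIV. x $ j * u j s a)"

text \<open>The generalized Maurer-Cartan equations. Here \<open>br\<close> is the bracket of the tangent algebra, in
  components; \<open>field u\<close> and \<open>field v\<close> are \<open>L\<close> and \<open>R\<close> (on \<open>G\<close>) or \<open>S\<close> and \<open>T\<close> (on \<open>X\<close>). The relation of \<open>br\<close>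
  to the loop product enters only through these equations, so that no sign convention for
  the structure constants has to be fixed.\<close>

definition maurer_cartan ::
  "('a, 'i::finite) chart \<Rightarrow> (real ^ 'n \<Rightarrow> real ^ 'n \<Rightarrow> real ^ 'n) \<Rightarrow>
   ('n::finite \<Rightarrow> 'i \<Rightarrow> 'a \<Rightarrow> real) \<Rightarrow> ('n \<Rightarrow> 'i \<Rightarrow> 'a \<Rightarrow> real) \<Rightarrow> bool" where
  "maurer_cartan \<kappa> br u v \<longleftrightarrow> (\<forall>x y. \<forall>a\<in>dom_of \<kappa>. \<forall>s.
     commutator \<kappa> (field u x) (field u y) s a
       = field u (br x y) s a - 2 * commutator \<kappa> (field u x) (field v y) s a \<and>
     commutator \<kappa> (field v x) (field v y) s a
       = field v (br y x) s a - 2 * commutator \<kappa> (field v x) (field u y) s a \<and>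
     commutator \<kappa> (field u x) (field v y) s a = commutator \<kappa> (field v x) (field u y) s a)"

definition auxiliary_functions ::
  "('a, 'i::finite) chart \<Rightarrow> ('n::finite \<Rightarrow> 'i \<Rightarrow> 'a \<Rightarrow> real) \<Rightarrow>
   ('n \<Rightarrow> 'i \<Rightarrow> 'a \<Rightarrow> real) \<Rightarrow> ('n \<Rightarrow> 'i \<Rightarrow> 'a \<Rightarrow> real) \<Rightarrow> bool" where
  "auxiliary_functions \<kappa> u v w \<longleftrightarrow>
     (\<forall>j s. smooth_fun \<kappa> (u j s) \<and> smooth_fun \<kappa> (v j s) \<and> smooth_fun \<kappa> (w j s)) \<and>
     (\<forall>j s. \<forall>a\<in>dom_of \<kappa>. u j s a + v j s a + w j s a = 0)"

definition secondary ::
  "('a, 'i::finite) chart \<Rightarrow> ('n \<Rightarrow> 'i \<Rightarrow> 'a \<Rightarrow> real) \<Rightarrow> 'n \<Rightarrow> 'n \<Rightarrow> 'i \<Rightarrow> 'a \<Rightarrow> real" where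
  "secondary \<kappa> u j k s a =
     (\<Sum>p\<in>UNIV. u k p a * pd \<kappa> p (u j s) a - u j p a * pd \<kappa> p (u k s) a)"

definition yamaguti ::
  "('a, 'i::finite) chart \<Rightarrow> ('n \<Rightarrow> 'i \<Rightarrow> 'a \<Rightarrow> real) \<Rightarrow> ('n \<Rightarrow> 'i \<Rightarrow> 'a \<Rightarrow> real) \<Rightarrow>
   ('n \<Rightarrow> 'i \<Rightarrow> 'a \<Rightarrow> real) \<Rightarrow> 'n \<Rightarrow> 'n \<Rightarrow> 'i \<Rightarrow> 'a \<Rightarrow> real" where
  "yamaguti \<kappa> u v w j k s a =
     1 / 6 * (secondary \<kappa> u j k s a + secondary \<kappa> v j k s a + secondary \<kappa> w j k s a)"


section \<open>The systems of differential equations, on the level of jets\<close>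

text \<open>A 1-jet of a map \<open>\<phi>\<close> from \<open>G \<times> X\<close> to \<open>X\<close> consists of the point \<open>(g, A)\<close>, the value \<open>B = \<phi>(g, A)\<close>
  and the first-order partial derivatives
  \<open>p \<mu> s = \<partial>\<phi>\<^sup>\<mu>/\<partial>g\<^sup>s\<close>, \<open>q \<mu> \<nu> = \<partial>\<phi>\<^sup>\<mu>/\<partial>A\<^sup>\<nu>\<close>.
  A family of equations \<open>X\<^sub>j \<phi>\<^sup>\<mu> + F\<^sub>j\<^sup>\<mu>(\<phi>) = 0\<close> with
  \<open>X\<^sub>j = a\<^sup>s\<^sub>j(g) \<partial>/\<partial>g\<^sup>s + b\<^sup>\<nu>\<^sub>j(A) \<partial>/\<partial>A\<^sup>\<nu>\<close> is given by \<open>a\<close>, \<open>b\<close>, \<open>F\<close>.\<close>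

definition family_holds ::
  "('n::finite \<Rightarrow> 'n \<Rightarrow> 'g \<Rightarrow> real) \<Rightarrow> ('n \<Rightarrow> 'm::finite \<Rightarrow> 'x \<Rightarrow> real) \<Rightarrow> ('n \<Rightarrow> 'm \<Rightarrow> 'x \<Rightarrow> real) \<Rightarrow>
   'g \<Rightarrow> 'x \<Rightarrow> 'x \<Rightarrow> ('m \<Rightarrow> 'n \<Rightarrow> real) \<Rightarrow> ('m \<Rightarrow> 'm \<Rightarrow> real) \<Rightarrow> bool" where
  "family_holds a b F g A B p q \<longleftrightarrow>
     (\<forall>j \<mu>. (\<Sum>s\<in>UNIV. a j s g * p \<mu> s) + (\<Sum>\<nu>\<in>UNIV. b j \<nu> A * q \<mu> \<nu>) + F j \<mu> B = 0)"

text \<open>The result of applying \<open>X\<^sub>k\<close> to the left-hand side of the \<open>j\<close>-th equation. The arguments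
  \<open>pp \<mu> s t = \<partial>\<^sup>2\<phi>\<^sup>\<mu>/\<partial>g\<^sup>t\<partial>g\<^sup>s\<close>, \<open>pq \<mu> s \<nu> = \<partial>\<^sup>2\<phi>\<^sup>\<mu>/\<partial>A\<^sup>\<nu>\<partial>g\<^sup>s\<close>, \<open>qp \<mu> \<nu> s = \<partial>\<^sup>2\<phi>\<^sup>\<mu>/\<partial>g\<^sup>s\<partial>A\<^sup>\<nu>\<close>,
  \<open>qq \<mu> \<nu> \<lambda> = \<partial>\<^sup>2\<phi>\<^sup>\<mu>/\<partial>A\<^sup>\<lambda>\<partial>A\<^sup>\<nu>\<close> are the second-order derivatives; \<open>z \<nu>\<close> is the quantity used for
  \<open>X\<^sub>k \<phi>\<^sup>\<nu>\<close> in the chain rule for \<open>F\<^sub>j\<^sup>\<mu>(\<phi>)\<close>.\<close>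

definition prolonged ::
  "('g, 'n::finite) chart \<Rightarrow> ('x, 'm::finite) chart \<Rightarrow>
   ('n \<Rightarrow> 'n \<Rightarrow> 'g \<Rightarrow> real) \<Rightarrow> ('n \<Rightarrow> 'm \<Rightarrow> 'x \<Rightarrow> real) \<Rightarrow> ('n \<Rightarrow> 'm \<Rightarrow> 'x \<Rightarrow> real) \<Rightarrow>
   'g \<Rightarrow> 'x \<Rightarrow> 'x \<Rightarrow> ('m \<Rightarrow> 'n \<Rightarrow> real) \<Rightarrow> ('m \<Rightarrow> 'm \<Rightarrow> real) \<Rightarrow>
   ('m \<Rightarrow> 'n \<Rightarrow> 'n \<Rightarrow> real) \<Rightarrow> ('m \<Rightarrow> 'n \<Rightarrow> 'm \<Rightarrow> real) \<Rightarrow>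
   ('m \<Rightarrow> 'm \<Rightarrow> 'n \<Rightarrow> real) \<Rightarrow> ('m \<Rightarrow> 'm \<Rightarrow> 'm \<Rightarrow> real) \<Rightarrow>
   ('m \<Rightarrow> real) \<Rightarrow> 'n \<Rightarrow> 'n \<Rightarrow> 'm \<Rightarrow> real" where
  "prolonged \<kappa> \<psi> a b F g A B p q pp pq qp qq z k j \<mu> =
     (\<Sum>s\<in>UNIV. (\<Sum>t\<in>UNIV. a k t g * pd \<kappa> t (a j s) g) * p \<mu> s
        + a j s g * ((\<Sum>t\<in>UNIV. a k t g * pp \<mu> s t) + (\<Sum>\<nu>\<in>UNIV. b k \<nu> A * pq \<mu> s \<nu>)))
   + (\<Sum>\<nu>\<in>UNIV. (\<Sum>\<rho>\<in>UNIV. b k \<rho> A * pd \<psi> \<rho> (b j \<nu>) A) * q \<mu> \<nu>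
        + b j \<nu> A * ((\<Sum>s\<in>UNIV. a k s g * qp \<mu> \<nu> s) + (\<Sum>\<rho>\<in>UNIV. b k \<rho> A * qq \<mu> \<nu> \<rho>)))
   + (\<Sum>\<nu>\<in>UNIV. pd \<psi> \<nu> (F j \<mu>) B * z \<nu>)"

text \<open>The integrability conditions: the difference of \<open>X\<^sub>k\<close> applied to the \<open>j\<close>-th equation and \<open>X\<^sub>j\<close>
  applied to the \<open>k\<close>-th one, with \<open>-F(\<phi>)\<close> substituted for \<open>X\<phi>\<close> in the derivatives of \<open>F(\<phi>)\<close>.
  For symmetric second-order derivatives these cancel, so the condition is
  one on the 1-jet only, and the quantification over them is immaterial.\<close>

definition integrability ::
  "('g, 'n::finite) chart \<Rightarrow> ('x, 'm::finite) chart \<Rightarrow>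
   ('n \<Rightarrow> 'n \<Rightarrow> 'g \<Rightarrow> real) \<Rightarrow> ('n \<Rightarrow> 'm \<Rightarrow> 'x \<Rightarrow> real) \<Rightarrow> ('n \<Rightarrow> 'm \<Rightarrow> 'x \<Rightarrow> real) \<Rightarrow>
   'g \<Rightarrow> 'x \<Rightarrow> 'x \<Rightarrow> ('m \<Rightarrow> 'n \<Rightarrow> real) \<Rightarrow> ('m \<Rightarrow> 'm \<Rightarrow> real) \<Rightarrow> bool" where
  "integrability \<kappa> \<psi> a b F g A B p q \<longleftrightarrow>
     (\<forall>j k \<mu>. \<forall>pp pq qp qq.
        (\<forall>s t. pp \<mu> s t = pp \<mu> t s) \<longrightarrow> (\<forall>s \<nu>. pq \<mu> s \<nu> = qp \<mu> \<nu> s) \<longrightarrow>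
        (\<forall>\<nu> \<rho>. qq \<mu> \<nu> \<rho> = qq \<mu> \<rho> \<nu>) \<longrightarrow>
        prolonged \<kappa> \<psi> a b F g A B p q pp pq qp qq (\<lambda>\<nu>. - F k \<nu> B) k j \<mu>
        - prolonged \<kappa> \<psi> a b F g A B p q pp pq qp qq (\<lambda>\<nu>. - F j \<nu> B) j k \<mu> = 0)"

text \<open>The system for \<open>S\<^sub>gA\<close> and its integrability conditions.\<close>

definition gle_S where
  "gle_S u v w S T P g A B p q \<longleftrightarrow>
     family_holds u T P g A B p q \<and> family_holds v P T g A B p q \<and> family_holds w S S g A B p q"

definition integrability_S where
  "integrability_S \<kappa> \<psi> u v w S T P g A B p q \<longleftrightarrow>
     integrability \<kappa> \<psi> u T P g A B p q \<and> integrability \<kappa> \<psi> v P T g A B p q \<and>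
     integrability \<kappa> \<psi> w S S g A B p q"

text \<open>The system for \<open>T\<^sub>gA\<close> and its integrability conditions.\<close>

definition gle_T where
  "gle_T u v w S T P g A B p q \<longleftrightarrow>
     family_holds v S P g A B p q \<and> family_holds u P S g A B p q \<and> family_holds w T T g A B p q"

definition integrability_T where
  "integrability_T \<kappa> \<psi> u v w S T P g A B p q \<longleftrightarrow>
     integrability \<kappa> \<psi> v S P g A B p q \<and> integrability \<kappa> \<psi> u P S g A B p q \<and>
     integrability \<kappa> \<psi> w T T g A B p q"

text \<open>\<open>solves \<kappa> \<psi> \<phi> Q\<close>: the condition \<open>Q\<close> holds for all 1-jets of the map \<open>\<phi>\<close> that are expressible
  in the given local coordinates.\<close>

definition solves ::
  "('g, 'n::finite) chart \<Rightarrow> ('x, 'm::finite) chart \<Rightarrow> ('g \<Rightarrow> 'x \<Rightarrow> 'x) \<Rightarrow>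
   ('g \<Rightarrow> 'x \<Rightarrow> 'x \<Rightarrow> ('m \<Rightarrow> 'n \<Rightarrow> real) \<Rightarrow> ('m \<Rightarrow> 'm \<Rightarrow> real) \<Rightarrow> bool) \<Rightarrow> bool" where
  "solves \<kappa> \<psi> \<phi> Q \<longleftrightarrow>
     (\<forall>g\<in>dom_of \<kappa>. \<forall>A\<in>dom_of \<psi>. \<phi> g A \<in> dom_of \<psi> \<longrightarrow>
        Q g A (\<phi> g A)
          (\<lambda>\<mu> s. pd \<kappa> s (\<lambda>h. coords \<psi> (\<phi> h A) $ \<mu>) g)
          (\<lambda>\<mu> \<nu>. pd \<psi> \<nu> (\<lambda>C. coords \<psi> (\<phi> g C) $ \<mu>) A))"

definition yamaguti_relations ::
  "('g, 'n::finite) chart \<Rightarrow> ('x, 'm::finite) chart \<Rightarrow>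
   ('n \<Rightarrow> 'n \<Rightarrow> 'g \<Rightarrow> real) \<Rightarrow> ('n \<Rightarrow> 'n \<Rightarrow> 'g \<Rightarrow> real) \<Rightarrow> ('n \<Rightarrow> 'n \<Rightarrow> 'g \<Rightarrow> real) \<Rightarrow>
   ('n \<Rightarrow> 'm \<Rightarrow> 'x \<Rightarrow> real) \<Rightarrow> ('n \<Rightarrow> 'm \<Rightarrow> 'x \<Rightarrow> real) \<Rightarrow> ('n \<Rightarrow> 'm \<Rightarrow> 'x \<Rightarrow> real) \<Rightarrow>
   'g \<Rightarrow> 'x \<Rightarrow> 'x \<Rightarrow> ('m \<Rightarrow> 'n \<Rightarrow> real) \<Rightarrow> ('m \<Rightarrow> 'm \<Rightarrow> real) \<Rightarrow> bool" where
  "yamaguti_relations \<kappa> \<psi> u v w S T P g A B p q \<longleftrightarrow>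
     (\<forall>j k \<mu>. (\<Sum>s\<in>UNIV. yamaguti \<kappa> u v w j k s g * p \<mu> s)
        + (\<Sum>\<nu>\<in>UNIV. yamaguti \<psi> S T P j k \<nu> A * q \<mu> \<nu>) = yamaguti \<psi> S T P j k \<mu> B)"

end

theory Submission
  imports Defs
begin

text \<open>For \<open>c = [e\<^sub>k, e\<^sub>j]\<close> the generalized Maurer-Cartan equations and \<open>L + R + M = 0\<close> give
  \<open>u\<^sub>j\<^sub>k = 2 Y\<^sub>j\<^sub>k + (R\<^sub>c - M\<^sub>c) / 3\<close> and its cyclic permutations, and likewise on \<open>X\<close>. The integrability
  condition of a family \<open>(a, b, F)\<close> is \<open>a\<^sub>j\<^sub>k \<partial>\<phi>/\<partial>g + b\<^sub>j\<^sub>k \<partial>\<phi>/\<partial>A = F\<^sub>j\<^sub>k(\<phi>)\<close>. Inserting these formulas, it becomes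
  twice the Yamaguti relation plus a third of the difference of the other two families of the
  system, both taken at \<open>c\<close>. So each of the three conditions by itself is equivalent to the Yamaguti relation.\<close>

text \<open>The coefficients enter linearly, so contracting the index \<open>j\<close> with the
  components of \<open>c\<close> preserves the equations. This allows a family to be evaluated at a
  bracket of basis vectors, which need not be a basis vector.\<close>

lemma family_holds_field:
  assumes "family_holds a b F g A B p q"
  shows "(\<Sum>s\<in>UNIV. field a c s g * p \<mu> s) + (\<Sum>\<nu>\<in>UNIV. field b c \<nu> A * q \<mu> \<nu>) + field F c \<mu> B = 0"
proof -
  have 1: "(\<Sum>s\<in>UNIV. field a c s g * p \<mu> s) = (\<Sum>j\<in>UNIV. c $ j * (\<Sum>s\<in>UNIV. a j s g * p \<mu> s))"
    unfolding field_def sum_distrib_right sum_distrib_left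
    by (subst sum.swap) (simp only: mult.assoc)
  have 2: "(\<Sum>\<nu>\<in>UNIV. field b c \<nu> A * q \<mu> \<nu>) = (\<Sum>j\<in>UNIV. c $ j * (\<Sum>\<nu>\<in>UNIV. b j \<nu> A * q \<mu> \<nu>))"
    unfolding field_def sum_distrib_right sum_distrib_left
    by (subst sum.swap) (simp only: mult.assoc)
  have "(\<Sum>s\<in>UNIV. field a c s g * p \<mu> s) + (\<Sum>\<nu>\<in>UNIV. field b c \<nu> A * q \<mu> \<nu>) + field F c \<mu> B
      = (\<Sum>j\<in>UNIV. c $ j * ((\<Sum>s\<in>UNIV. a j s g * p \<mu> s) + (\<Sum>\<nu>\<in>UNIV. b j \<nu> A * q \<mu> \<nu>) + F j \<mu> B))"
    unfolding 1 2 by (simp only: field_def sum.distrib distrib_left)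
  then show ?thesis
    using assms unfolding family_holds_def by simp
qed

text \<open>Separates the terms free of second-order derivatives from the four second-order blocks,
  gathered in the last parenthesis, whose cancellation is to be shown.\<close>

lemma prolonged_split:
  "prolonged \<kappa> \<psi> a b F g A B p q pp pq qp qq z k j \<mu> =
     (\<Sum>s\<in>UNIV. (\<Sum>t\<in>UNIV. a k t g * pd \<kappa> t (a j s) g) * p \<mu> s)
   + (\<Sum>\<nu>\<in>UNIV. (\<Sum>\<rho>\<in>UNIV. b k \<rho> A * pd \<psi> \<rho> (b j \<nu>) A) * q \<mu> \<nu>)
   + (\<Sum>\<nu>\<in>UNIV. pd \<psi> \<nu> (F j \<mu>) B * z \<nu>)
   + ((\<Sum>s\<in>UNIV. \<Sum>t\<in>UNIV. a j s g * a k t g * pp \<mu> s t)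
   + (\<Sum>s\<in>UNIV. \<Sum>\<nu>\<in>UNIV. a j s g * b k \<nu> A * pq \<mu> s \<nu>)
   + (\<Sum>\<nu>\<in>UNIV. \<Sum>s\<in>UNIV. b j \<nu> A * a k s g * qp \<mu> \<nu> s)
   + (\<Sum>\<nu>\<in>UNIV. \<Sum>\<rho>\<in>UNIV. b j \<nu> A * b k \<rho> A * qq \<mu> \<nu> \<rho>))"
  unfolding prolonged_def
  by (simp add: sum.distrib distrib_left sum_distrib_left mult.assoc)

text \<open>Exchanging \<open>j\<close> and \<open>k\<close> leaves the sum of the second-order
  blocks unchanged, so they cancel. What remains are the commutators of the coefficient fields; the
  substituted \<open>- F\<close> produces the minus sign of the last term.\<close>

lemma prolonged_difference:
  assumes "\<And>s t. pp \<mu> s t = pp \<mu> t s" "\<And>s \<nu>. pq \<mu> s \<nu> = qp \<mu> \<nu> s" "\<And>\<nu> \<rho>. qq \<mu> \<nu> \<rho> = qq \<mu> \<rho> \<nu>"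
  shows "prolonged \<kappa> \<psi> a b F g A B p q pp pq qp qq (\<lambda>\<nu>. - F k \<nu> B) k j \<mu>
       - prolonged \<kappa> \<psi> a b F g A B p q pp pq qp qq (\<lambda>\<nu>. - F j \<nu> B) j k \<mu>
     = (\<Sum>s\<in>UNIV. secondary \<kappa> a j k s g * p \<mu> s) + (\<Sum>\<nu>\<in>UNIV. secondary \<psi> b j k \<nu> A * q \<mu> \<nu>)
       - secondary \<psi> F j k \<mu> B"
proof -
  have 1: "(\<Sum>s\<in>UNIV. \<Sum>t\<in>UNIV. a j s g * a k t g * pp \<mu> s t)
      = (\<Sum>s\<in>UNIV. \<Sum>t\<in>UNIV. a k s g * a j t g * pp \<mu> s t)"
    by (subst sum.swap) (intro sum.cong refl, simp add: assms(1))
  \<comment> \<open>The two mixed blocks of one prolongation match those of the other crosswise, so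
    this identity is used for both orders of the two indices.\<close>
  have 2: "(\<Sum>s\<in>UNIV. \<Sum>\<nu>\<in>UNIV. a j s g * b k \<nu> A * pq \<mu> s \<nu>)
      = (\<Sum>\<nu>\<in>UNIV. \<Sum>s\<in>UNIV. b k \<nu> A * a j s g * qp \<mu> \<nu> s)" for j k
    by (subst sum.swap) (simp add: assms(2) mult.commute)
  have 3: "(\<Sum>\<nu>\<in>UNIV. \<Sum>\<rho>\<in>UNIV. b j \<nu> A * b k \<rho> A * qq \<mu> \<nu> \<rho>)
      = (\<Sum>\<nu>\<in>UNIV. \<Sum>\<rho>\<in>UNIV. b k \<nu> A * b j \<rho> A * qq \<mu> \<nu> \<rho>)"
    by (subst sum.swap) (intro sum.cong refl, simp add: assms(3))
  show ?thesis
    unfolding prolonged_split 1 2 3 secondary_def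
    by (simp add: sum_subtractf left_diff_distrib right_diff_distrib sum_negf mult.commute)
qed

lemma integrability_iff:
  "integrability \<kappa> \<psi> a b F g A B p q \<longleftrightarrow>
     (\<forall>j k \<mu>. (\<Sum>s\<in>UNIV. secondary \<kappa> a j k s g * p \<mu> s) + (\<Sum>\<nu>\<in>UNIV. secondary \<psi> b j k \<nu> A * q \<mu> \<nu>)
       = secondary \<psi> F j k \<mu> B)" (is "?I \<longleftrightarrow> ?R")
proof
  assume I: ?I
  show ?R
  proof (intro allI)
    fix j k \<mu>
    \<comment> \<open>Vanishing second-order derivatives are symmetric, hence an admissible choice;
      any other symmetric choice gives the same relation.\<close>
    have "prolonged \<kappa> \<psi> a b F g A B p q (\<lambda>_ _ _. 0) (\<lambda>_ _ _. 0) (\<lambda>_ _ _. 0) (\<lambda>_ _ _. 0)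
          (\<lambda>\<nu>. - F k \<nu> B) k j \<mu>
        - prolonged \<kappa> \<psi> a b F g A B p q (\<lambda>_ _ _. 0) (\<lambda>_ _ _. 0) (\<lambda>_ _ _. 0) (\<lambda>_ _ _. 0)
          (\<lambda>\<nu>. - F j \<nu> B) j k \<mu> = 0"
      by (rule I[unfolded integrability_def, rule_format]) simp_all
    then show "(\<Sum>s\<in>UNIV. secondary \<kappa> a j k s g * p \<mu> s) + (\<Sum>\<nu>\<in>UNIV. secondary \<psi> b j k \<nu> A * q \<mu> \<nu>)
       = secondary \<psi> F j k \<mu> B"
      by (simp add: prolonged_difference)
  qed
next
  assume R: ?R
  show ?I
    unfolding integrability_def
    by (intro allI impI, subst prolonged_difference) (use R in auto)
qed

lemma smooth_fun_has_derivative: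
  assumes "smooth_fun \<kappa> f" "a \<in> dom_of \<kappa>"
  shows "((\<lambda>x. f (point_at \<kappa> x)) has_derivative
    frechet_derivative (\<lambda>x. f (point_at \<kappa> x)) (at (coords \<kappa> a))) (at (coords \<kappa> a))"
proof -
  have "Ck_on (Suc 0) (\<lambda>x. f (point_at \<kappa> x)) (coord_range \<kappa>)"
    using assms(1) unfolding smooth_fun_def smooth_on_def by blast
  then show ?thesis
    using assms(2) by (simp add: frechet_derivative_works)
qed

text \<open>Derivatives are local: on the open coordinate range the pullback of \<open>r\<close>
  equals that of \<open>- f - h\<close>, so it inherits its derivative.\<close>

lemma pd_minus_add:
  assumes "is_chart \<kappa>" "smooth_fun \<kappa> f" "smooth_fun \<kappa> h" "a \<in> dom_of \<kappa>"
    and "\<And>b. b \<in> dom_of \<kappa> \<Longrightarrow> f b + h b + r b = 0"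
  shows "pd \<kappa> i r a = - pd \<kappa> i f a - pd \<kappa> i h a"
proof -
  let ?D = "\<lambda>f. frechet_derivative (\<lambda>x. f (point_at \<kappa> x)) (at (coords \<kappa> a))"
  have "((\<lambda>x. - f (point_at \<kappa> x) - h (point_at \<kappa> x)) has_derivative (\<lambda>y. - ?D f y - ?D h y))
      (at (coords \<kappa> a))"
    by (intro derivative_intros smooth_fun_has_derivative assms)
  then have "((\<lambda>x. r (point_at \<kappa> x)) has_derivative (\<lambda>y. - ?D f y - ?D h y)) (at (coords \<kappa> a))"
  proof (rule has_derivative_transform_within_open)
    show "open (coord_range \<kappa>)"
      using assms(1) by (simp add: is_chart_def)
    show "coords \<kappa> a \<in> coord_range \<kappa>"
      using assms(4) by blast
    show "- f (point_at \<kappa> x) - h (point_at \<kappa> x) = r (point_at \<kappa> x)" if "x \<in> coord_range \<kappa>" for x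
      using assms(5)[of "point_at \<kappa> x"] inv_into_into[OF that] unfolding point_at_def by linarith
  qed
  then have "?D r = (\<lambda>y. - ?D f y - ?D h y)"
    by (rule frechet_derivative_at[symmetric])
  then show ?thesis
    by (simp add: pd_def)
qed

lemma field_axis: "field u (axis j 1) = u j"
  by (intro ext) (simp add: field_def axis_def if_distrib[of "\<lambda>c. c * _"] cong: if_cong)

lemma field_uminus: "field u (- c) s a = - field u c s a"
  by (simp add: field_def sum_negf)

text \<open>The order of the indices is reversed: this is [L_k, L_j] for the basis vectors e_k and
  e_j, which is why [e_k, e_j] appears later.\<close>

lemma secondary_eq_commutator: "secondary \<kappa> u j k s a = commutator \<kappa> (u k) (u j) s a"
  by (simp add: secondary_def commutator_def)

text \<open>Since M = -(L + R), bilinearity expands [M_k, M_j] as [L_k + R_k, L_j + R_j]; the two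
  signs cancel.\<close>

lemma secondary_third:
  assumes "is_chart \<kappa>" "auxiliary_functions \<kappa> u v w" "a \<in> dom_of \<kappa>"
  shows "secondary \<kappa> w j k s a = secondary \<kappa> u j k s a + secondary \<kappa> v j k s a
    + commutator \<kappa> (u k) (v j) s a + commutator \<kappa> (v k) (u j) s a"
proof -
  have pd_w: "pd \<kappa> i (w j s) a = - pd \<kappa> i (u j s) a - pd \<kappa> i (v j s) a" for i j s
    using assms unfolding auxiliary_functions_def by (intro pd_minus_add) auto
  have w: "w j s a = - u j s a - v j s a" for j s
  proof -
    have "u j s a + v j s a + w j s a = 0"
      using assms unfolding auxiliary_functions_def by blast
    then show ?thesis by linarith
  qed
  show ?thesis
    unfolding secondary_def commutator_def pd_w w
    by (simp add: sum.distrib[symmetric] algebra_simps)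
qed

text \<open>Put K = [L_k, R_j] and c = [e_k, e_j]. The three secondary functions are L_c - 2K, -R_c
  - 2K and L_c - R_c - 2K, so a sixth of their sum is Y = (L_c - R_c)/3 - K. Eliminating K and using
  L_c + R_c + M_c = 0 gives the cyclic form.\<close>

lemma secondary_eq_yamaguti:
  assumes "is_chart \<kappa>" "auxiliary_functions \<kappa> u v w" "maurer_cartan \<kappa> br u v"
    and "\<And>x y. br x y = - br y x" "a \<in> dom_of \<kappa>"
  defines "c \<equiv> \<lambda>j k. br (axis k 1) (axis j 1)"
  shows "secondary \<kappa> u j k s a = 2 * yamaguti \<kappa> u v w j k s a + (field v (c j k) s a - field w (c j k) s a) / 3"
    and "secondary \<kappa> v j k s a = 2 * yamaguti \<kappa> u v w j k s a + (field w (c j k) s a - field u (c j k) s a) / 3"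
    and "secondary \<kappa> w j k s a = 2 * yamaguti \<kappa> u v w j k s a + (field u (c j k) s a - field v (c j k) s a) / 3"
proof -
  let ?K = "commutator \<kappa> (u k) (v j) s a" and ?c = "c j k"
  note mc = assms(3)[unfolded maurer_cartan_def, rule_format, OF assms(5),
      of "axis k 1" "axis j 1" s, unfolded field_axis, folded c_def]
  have K: "commutator \<kappa> (v k) (u j) s a = ?K"
    using mc by simp
  have u: "secondary \<kappa> u j k s a = field u ?c s a - 2 * ?K"
    using mc by (simp add: secondary_eq_commutator c_def)
  \<comment> \<open>The equation for R carries the bracket with exchanged arguments; skew-symmetry
    turns its first term into -R_c.\<close>
  have "br (axis j 1) (axis k 1) = - ?c"
    unfolding c_def by (rule assms(4))
  then have v: "secondary \<kappa> v j k s a = - field v ?c s a - 2 * ?K"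
    using mc K by (simp add: secondary_eq_commutator field_uminus)
  have w: "secondary \<kappa> w j k s a = field u ?c s a - field v ?c s a - 2 * ?K"
    using secondary_third[OF assms(1,2,5)] u v K by simp
  have "field u ?c s a + field v ?c s a + field w ?c s a
      = (\<Sum>i\<in>UNIV. ?c $ i * (u i s a + v i s a + w i s a))"
    by (simp add: field_def sum.distrib distrib_left)
  also have "\<dots> = 0"
    using assms(2,5) by (simp add: auxiliary_functions_def)
  finally have fw: "field w ?c s a = - field u ?c s a - field v ?c s a"
    by linarith
  show "secondary \<kappa> u j k s a = 2 * yamaguti \<kappa> u v w j k s a + (field v ?c s a - field w ?c s a) / 3"
    and "secondary \<kappa> v j k s a = 2 * yamaguti \<kappa> u v w j k s a + (field w ?c s a - field u ?c s a) / 3"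
    and "secondary \<kappa> w j k s a = 2 * yamaguti \<kappa> u v w j k s a + (field u ?c s a - field v ?c s a) / 3"
    unfolding yamaguti_def u v w fw by (simp_all add: field_simps)
qed

text \<open>With E_2 and E_3 the left-hand sides of the two given families at \<open>c j k\<close>,
  the condition differs from twice the relation by (E_2 - E_3)/3, which vanishes. In the formula for
  \<open>F\<close> the subscripts 2 and 3 are interchanged, because \<open>F\<close> is added in a
  family but its secondary function is subtracted in the condition.\<close>

lemma integrability_iff_relation:
  assumes "family_holds a\<^sub>2 b\<^sub>2 F\<^sub>2 g A B p q" "family_holds a\<^sub>3 b\<^sub>3 F\<^sub>3 g A B p q"
    and a: "\<And>j k s. secondary \<kappa> a j k s g = 2 * y j k s g + (field a\<^sub>2 (c j k) s g - field a\<^sub>3 (c j k) s g) / 3"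
    and b: "\<And>j k \<nu>. secondary \<psi> b j k \<nu> A = 2 * Y j k \<nu> A + (field b\<^sub>2 (c j k) \<nu> A - field b\<^sub>3 (c j k) \<nu> A) / 3"
    and F: "\<And>j k \<mu>. secondary \<psi> F j k \<mu> B = 2 * Y j k \<mu> B + (field F\<^sub>3 (c j k) \<mu> B - field F\<^sub>2 (c j k) \<mu> B) / 3"
  shows "integrability \<kappa> \<psi> a b F g A B p q \<longleftrightarrow>
    (\<forall>j k \<mu>. (\<Sum>s\<in>UNIV. y j k s g * p \<mu> s) + (\<Sum>\<nu>\<in>UNIV. Y j k \<nu> A * q \<mu> \<nu>) = Y j k \<mu> B)"
proof -
  have eq: "(\<Sum>s\<in>UNIV. secondary \<kappa> a j k s g * p \<mu> s) + (\<Sum>\<nu>\<in>UNIV. secondary \<psi> b j k \<nu> A * q \<mu> \<nu>)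
        - secondary \<psi> F j k \<mu> B
      = 2 * ((\<Sum>s\<in>UNIV. y j k s g * p \<mu> s) + (\<Sum>\<nu>\<in>UNIV. Y j k \<nu> A * q \<mu> \<nu>) - Y j k \<mu> B)" for j k \<mu>
  proof -
    have 1: "(\<Sum>s\<in>UNIV. secondary \<kappa> a j k s g * p \<mu> s) = 2 * (\<Sum>s\<in>UNIV. y j k s g * p \<mu> s)
        + ((\<Sum>s\<in>UNIV. field a\<^sub>2 (c j k) s g * p \<mu> s) - (\<Sum>s\<in>UNIV. field a\<^sub>3 (c j k) s g * p \<mu> s)) / 3"
      unfolding a sum_distrib_left sum_subtractf[symmetric] sum_divide_distrib sum.distrib[symmetric]
      by (intro sum.cong refl) (simp add: field_simps)
    have 2: "(\<Sum>\<nu>\<in>UNIV. secondary \<psi> b j k \<nu> A * q \<mu> \<nu>) = 2 * (\<Sum>\<nu>\<in>UNIV. Y j k \<nu> A * q \<mu> \<nu>)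
        + ((\<Sum>\<nu>\<in>UNIV. field b\<^sub>2 (c j k) \<nu> A * q \<mu> \<nu>) - (\<Sum>\<nu>\<in>UNIV. field b\<^sub>3 (c j k) \<nu> A * q \<mu> \<nu>)) / 3"
      unfolding b sum_distrib_left sum_subtractf[symmetric] sum_divide_distrib sum.distrib[symmetric]
      by (intro sum.cong refl) (simp add: field_simps)
    show ?thesis
      unfolding 1 2 F
      using family_holds_field[OF assms(1), of "c j k" \<mu>] family_holds_field[OF assms(2), of "c j k" \<mu>]
      by (simp add: field_simps)
  qed
  have "(\<Sum>s\<in>UNIV. secondary \<kappa> a j k s g * p \<mu> s) + (\<Sum>\<nu>\<in>UNIV. secondary \<psi> b j k \<nu> A * q \<mu> \<nu>)
        = secondary \<psi> F j k \<mu> B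
      \<longleftrightarrow> (\<Sum>s\<in>UNIV. y j k s g * p \<mu> s) + (\<Sum>\<nu>\<in>UNIV. Y j k \<nu> A * q \<mu> \<nu>) = Y j k \<mu> B" for j k \<mu>
    using eq[of j k \<mu>] by auto
  then show ?thesis
    unfolding integrability_iff by simp
qed

theorem theorem5p1:
  fixes mult :: "'g::{t2_space, second_countable_topology} \<Rightarrow> 'g \<Rightarrow> 'g" and e :: 'g
    and atlasG :: "('g, 'n::finite) chart set" and \<kappa> :: "('g, 'n) chart"
    and atlasX :: "('x::{t2_space, second_countable_topology}, 'm::finite) chart set"
    and \<psi> :: "('x, 'm) chart"
    and Smap Tmap :: "'g \<Rightarrow> 'x \<Rightarrow> 'x"
    and u v w :: "'n \<Rightarrow> 'n \<Rightarrow> 'g \<Rightarrow> real"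
    and S T P :: "'n \<Rightarrow> 'm \<Rightarrow> 'x \<Rightarrow> real"
    and br :: "real ^ 'n \<Rightarrow> real ^ 'n \<Rightarrow> real ^ 'n"
  assumes "analytic_moufang_loop atlasG mult e"
    and "local_coordinates real_analytic_on atlasG \<kappa>"
    and "manifold_atlas smooth_on atlasX"
    and "local_coordinates smooth_on atlasX \<psi>"
    and "auxiliary_functions \<kappa> u v w"
    and "auxiliary_functions \<psi> S T P"
    and "regular_map2 smooth_on atlasG atlasX atlasX Smap"
    and "regular_map2 smooth_on atlasG atlasX atlasX Tmap"
    and "solves \<kappa> \<psi> Smap (gle_S u v w S T P)"
    and "solves \<kappa> \<psi> Tmap (gle_T u v w S T P)"
    and "bilinear br" and "\<And>x y. br x y = - br y x"
    and "maurer_cartan \<kappa> br u v"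
    and "maurer_cartan \<psi> br S T"
  shows "\<forall>g\<in>dom_of \<kappa>. \<forall>A\<in>dom_of \<psi>. \<forall>B\<in>dom_of \<psi>. \<forall>p q.
      (gle_S u v w S T P g A B p q \<longrightarrow>
        (integrability_S \<kappa> \<psi> u v w S T P g A B p q \<longleftrightarrow>
         yamaguti_relations \<kappa> \<psi> u v w S T P g A B p q)) \<and>
      (gle_T u v w S T P g A B p q \<longrightarrow>
        (integrability_T \<kappa> \<psi> u v w S T P g A B p q \<longleftrightarrow>
         yamaguti_relations \<kappa> \<psi> u v w S T P g A B p q))"
proof (intro ballI allI conjI impI)
  fix g A B p q
  assume g: "g \<in> dom_of \<kappa>" and A: "A \<in> dom_of \<psi>" and B: "B \<in> dom_of \<psi>"
  have "is_chart \<kappa>" "is_chart \<psi>"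
    using assms(2,4) by (simp_all add: local_coordinates_def)
  \<comment> \<open>On the manifold of \<open>\<psi>\<close> the formulas are needed at two points:
    at \<open>A\<close> for the coefficients of the fields and at \<open>B\<close> for
    \<open>F\<close>.\<close>
  note G = secondary_eq_yamaguti[OF \<open>is_chart \<kappa>\<close> assms(5,13,12) g]
    and XA = secondary_eq_yamaguti[OF \<open>is_chart \<psi>\<close> assms(6,14,12) A]
    and XB = secondary_eq_yamaguti[OF \<open>is_chart \<psi>\<close> assms(6,14,12) B]
    and relation_iff = integrability_iff_relation[where y = "yamaguti \<kappa> u v w"
      and Y = "yamaguti \<psi> S T P" and c = "\<lambda>j k. br (axis k 1) (axis j 1)"]
  show "integrability_S \<kappa> \<psi> u v w S T P g A B p q \<longleftrightarrow> yamaguti_relations \<kappa> \<psi> u v w S T P g A B p q"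
    if "gle_S u v w S T P g A B p q"
  proof -
    have 1: "family_holds u T P g A B p q" and 2: "family_holds v P T g A B p q"
      and 3: "family_holds w S S g A B p q"
      using that by (simp_all add: gle_S_def)
    \<comment> \<open>Along the families of \<open>u\<close>, \<open>v\<close>, \<open>w\<close> the
      coefficients on X run through \<open>T\<close>, \<open>P\<close>, \<open>S\<close>, a cyclic
      permutation of \<open>S\<close>, \<open>T\<close>, \<open>P\<close>, while \<open>F\<close>
      runs through \<open>P\<close>, \<open>T\<close>, \<open>S\<close>, the opposite orientation
      that the sign in \<open>relation_iff\<close> demands.\<close>
    show ?thesis
      unfolding integrability_S_def yamaguti_relations_def
        relation_iff[OF 2 3 G(1) XA(2) XB(3)]
        relation_iff[OF 3 1 G(2) XA(3) XB(2)]
        relation_iff[OF 1 2 G(3) XA(1) XB(1)] by simp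
  qed
  show "integrability_T \<kappa> \<psi> u v w S T P g A B p q \<longleftrightarrow> yamaguti_relations \<kappa> \<psi> u v w S T P g A B p q"
    if "gle_T u v w S T P g A B p q"
  proof -
    have 1: "family_holds v S P g A B p q" and 2: "family_holds u P S g A B p q"
      and 3: "family_holds w T T g A B p q"
      using that by (simp_all add: gle_T_def)
    \<comment> \<open>This system lists \<open>v\<close> before \<open>u\<close>, so the two
      auxiliary families appear in the reverse of the listed cyclic order. Read along
      \<open>u\<close>, \<open>v\<close>, \<open>w\<close>, the coefficients are \<open>P\<close>,
      \<open>S\<close>, \<open>T\<close> and \<open>F\<close> is \<open>S\<close>, \<open>P\<close>,
      \<open>T\<close>, with the same orientations as before.\<close>
    show ?thesis
      unfolding integrability_T_def yamaguti_relations_def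
        relation_iff[OF 3 2 G(2) XA(1) XB(3)]
        relation_iff[OF 1 3 G(1) XA(3) XB(1)]
        relation_iff[OF 2 1 G(3) XA(2) XB(2)] by simp
  qed
qed

end
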